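(* Let $(X,\mathsf{d},\mu)$ be a metric measure space. For $x\in X$ and $r>0$ set $$\varepsilon_x(r):=\sup_{y\in B_r(x)}\left|1-\frac{\mu(B_r(x))}{\mu(B_r(y))}\right|.$$ Let $u\in L^1_{\mathrm{loc}}(X,\mu)$. Then for any $x\in \mathrm{Leb}(u)$ such that $\varepsilon_x(r)=O(r^2)$ as $r\downarrow 0$, it holds that $$\lim_{r\downarrow 0}\left|\Delta^{\mathsf d}_{\mu,r}u(x)-\tilde\Delta^{\mathsf d}_{\mu,r}u(x)\right|=0.$$ In particular, for such an $x$, $\Delta^{\mathsf d}_{\mu,r}u(x)$ converges as $r\downarrow 0$ if and only if $\tilde\Delta^{\mathsf d}_{\mu,r}u(x)$ does, in which case the two limits coincide: $\Delta^{\mathsf d}_{\mu}u(x)=\tilde\Delta^{\mathsf d}_{\mu}u(x)$.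
   Context: A metric measure space $(X,\mathsf d,\mu)$ is a metric space $(X,\mathsf d)$ with a fully supported Borel measure $\mu$ such that $0<\mu(B_r(x))<+\infty$ for all $x\in X$, $r>0$, where $B_r(x)=\{y:\mathsf d(x,y)<r\}$. $L^1_{\mathrm{loc}}(X,\mu)$ is the set of $\mu$-measurable functions that are integrable on some neighborhood of each point. $\fint_A f\,d\mu:=\frac1{\mu(A)}\int_A f\,d\mu$. For $u\in L^1_{\mathrm{loc}}(X,\mu)$, a point $x$ is a Lebesgue point of $u$ (written $x\in\mathrm{Leb}(u)$) if there is a real number $u^*(x)$ with $\lim_{r\downarrow0}\fint_{B_r(x)}|u(y)-u^*(x)|\,d\mu(y)=0$. For $x\in \mathrm{Leb}(u)$ and $r>0$, $$\Delta^{\mathsf d}_{\mu,r}u(x):=\frac1{r^2}\fint_{B_r(x)}(u(y)-u^*(x))\,d\mu(y),$$ $$\tilde\Delta^{\mathsf d}_{\mu,r}u(x):=\frac1{2r^2}\fint_{B_r(x)}(u(y)-u^*(x))\left(1+\frac{\mu(B_r(x))}{\mu(B_r(y))}\right)d\mu(y).$$ When the (finite) limits as $r\downarrow0$ exist they are denoted $\Delta^{\mathsf d}_{\mu}u(x)$ (pointwise AMV Laplacian) and $\tilde\Delta^{\mathsf d}_{\mu}u(x)$ (pointwise SAMV Laplacian). *)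

theory Defs
  imports "HOL-Analysis.Analysis"
begin

text \<open>The metric space is the type \<open>'a\<close> itself, with its distance \<open>dist\<close>.\<close>

locale metric_measure_space =
  fixes \<mu> :: "'a::metric_space measure"
  assumes sets_eq_borel: "sets \<mu> = sets borel"
    and full_support: "\<And>U. open U \<Longrightarrow> U \<noteq> {} \<Longrightarrow> 0 < emeasure \<mu> U"
    and ball_pos: "\<And>x r. 0 < r \<Longrightarrow> 0 < emeasure \<mu> (ball x r)"
    and ball_finite: "\<And>x r. 0 < r \<Longrightarrow> emeasure \<mu> (ball x r) < \<infinity>"

text \<open>A function is \<open>\<mu>\<close>-measurable if it is measurable for the completion of \<open>\<mu>\<close>. Integrals are
  therefore taken with respect to the completion; for Borel functions this is the same as
  integrating with respect to \<open>\<mu>\<close>.\<close>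

definition L1_loc :: "'a::metric_space measure \<Rightarrow> ('a \<Rightarrow> real) set" where
  "L1_loc \<mu> = {u \<in> borel_measurable (completion \<mu>).
     \<forall>x. \<exists>U. open U \<and> x \<in> U \<and> set_integrable (completion \<mu>) U u}"

definition mean_integral :: "'a measure \<Rightarrow> 'a set \<Rightarrow> ('a \<Rightarrow> real) \<Rightarrow> real" where
  "mean_integral \<mu> A f = (1 / measure \<mu> A) * (LINT y:A|completion \<mu>. f y)"

definition is_Lebesgue_value ::
    "'a::metric_space measure \<Rightarrow> ('a \<Rightarrow> real) \<Rightarrow> 'a \<Rightarrow> real \<Rightarrow> bool" where
  "is_Lebesgue_value \<mu> u x c \<longleftrightarrow>
     ((\<lambda>r. mean_integral \<mu> (ball x r) (\<lambda>y. \<bar>u y - c\<bar>)) \<longlongrightarrow> 0) (at_right 0)"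

definition Leb :: "'a::metric_space measure \<Rightarrow> ('a \<Rightarrow> real) \<Rightarrow> 'a set" where
  "Leb \<mu> u = {x. \<exists>c. is_Lebesgue_value \<mu> u x c}"

text \<open>The number \<open>u\<^sup>*(x)\<close>; it is unique if \<open>u \<in> L1_loc \<mu>\<close> and \<open>x \<in> Leb \<mu> u\<close>.\<close>

definition Lebesgue_value :: "'a::metric_space measure \<Rightarrow> ('a \<Rightarrow> real) \<Rightarrow> 'a \<Rightarrow> real" where
  "Lebesgue_value \<mu> u x = (THE c. is_Lebesgue_value \<mu> u x c)"

definition AMV_Laplacian_at_scale ::
    "'a::metric_space measure \<Rightarrow> real \<Rightarrow> ('a \<Rightarrow> real) \<Rightarrow> 'a \<Rightarrow> real" where
  "AMV_Laplacian_at_scale \<mu> r u x =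
     (1 / r\<^sup>2) * mean_integral \<mu> (ball x r) (\<lambda>y. u y - Lebesgue_value \<mu> u x)"

definition SAMV_Laplacian_at_scale ::
    "'a::metric_space measure \<Rightarrow> real \<Rightarrow> ('a \<Rightarrow> real) \<Rightarrow> 'a \<Rightarrow> real" where
  "SAMV_Laplacian_at_scale \<mu> r u x =
     (1 / (2 * r\<^sup>2)) * mean_integral \<mu> (ball x r)
       (\<lambda>y. (u y - Lebesgue_value \<mu> u x) * (1 + measure \<mu> (ball x r) / measure \<mu> (ball y r)))"

text \<open>The pointwise Laplacians are meaningful only where the respective limit exists in \<open>\<real>\<close>.\<close>

definition AMV_Laplacian :: "'a::metric_space measure \<Rightarrow> ('a \<Rightarrow> real) \<Rightarrow> 'a \<Rightarrow> real" where
  "AMV_Laplacian \<mu> u x = Lim (at_right 0) (\<lambda>r. AMV_Laplacian_at_scale \<mu> r u x)"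

definition SAMV_Laplacian :: "'a::metric_space measure \<Rightarrow> ('a \<Rightarrow> real) \<Rightarrow> 'a \<Rightarrow> real" where
  "SAMV_Laplacian \<mu> u x = Lim (at_right 0) (\<lambda>r. SAMV_Laplacian_at_scale \<mu> r u x)"

text \<open>Extended-real valued, since the supremum may be infinite.\<close>

definition ball_ratio_deviation :: "'a::metric_space measure \<Rightarrow> 'a \<Rightarrow> real \<Rightarrow> ereal" where
  "ball_ratio_deviation \<mu> x r =
     (SUP y\<in>ball x r. ereal \<bar>1 - measure \<mu> (ball x r) / measure \<mu> (ball y r)\<bar>)"

end

theory Submission
  imports Defs
begin

text \<open>
  At a scale \<open>r\<close> the two operators differ by the mean over the ball of \<open>u - u\<^sup>*(x)\<close> times
  \<open>(1 - \<mu>(B\<^sub>r(x)) / \<mu>(B\<^sub>r(y))) / (2 r\<^sup>2)\<close>. This factor is bounded by assumption, and the mean of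
  \<open>\<bar>u - u\<^sup>*(x)\<bar>\<close> tends to zero because \<open>x\<close> is a Lebesgue point. The integral may be split because
  \<open>y \<mapsto> \<mu>(B\<^sub>r(y))\<close> is lower semicontinuous, hence Borel.
\<close>

context metric_measure_space
begin

lemma ball_in_sets [measurable, simp]: "ball x r \<in> sets \<mu>"
  by (simp add: sets_eq_borel)

lemma emeasure_ball_finite [simp]: "emeasure \<mu> (ball x r) < top"
  using ball_finite[of r x] by (cases "0 < r") (auto simp: ball_empty)

lemma emeasure_ball_eq: "emeasure \<mu> (ball x r) = ennreal (measure \<mu> (ball x r))"
  using emeasure_ball_finite[THEN less_imp_neq] by (intro emeasure_eq_ennreal_measure)

lemma measure_ball_pos: "0 < r \<Longrightarrow> 0 < measure \<mu> (ball x r)"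
  using ball_pos[of r x] by (simp add: emeasure_ball_eq ennreal_less_zero_iff)

text \<open>Lower semicontinuity of the ball measure. By continuity from below, a slightly smaller
  concentric ball already has measure above \<open>a\<close>, and every ball of radius
  \<open>r\<close> with nearby centre contains it.\<close>

lemma open_superlevel_measure_ball: "open {y. a < measure \<mu> (ball y r)}"
proof (subst open_dist, intro ballI)
  fix y assume "y \<in> {y. a < measure \<mu> (ball y r)}"
  then have y: "a < measure \<mu> (ball y r)" by simp
  \<comment> \<open>For small \<open>n\<close> the radius may be nonpositive; then
    \<open>A n\<close> is empty, which is harmless.\<close>
  define A where "A n = ball y (r - 1 / real (Suc n))" for n
  have inc: "incseq A"
    unfolding A_def by (intro incseq_SucI subset_ball) (simp add: field_simps)
  have un: "(\<Union>n. A n) = ball y r"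
  proof
    show "(\<Union>n. A n) \<subseteq> ball y r"
      unfolding A_def by (intro UN_least subset_ball) simp
    show "ball y r \<subseteq> (\<Union>n. A n)"
    proof
      fix z assume "z \<in> ball y r"
      then have "0 < r - dist y z" by simp
      then obtain n where "inverse (real (Suc n)) < r - dist y z"
        using reals_Archimedean by blast
      then have "z \<in> A n" unfolding A_def by (simp add: inverse_eq_divide)
      then show "z \<in> (\<Union>n. A n)" by blast
    qed
  qed
  have "(\<lambda>n. measure \<mu> (A n)) \<longlonglongrightarrow> measure \<mu> (\<Union>n. A n)"
  proof (rule Lim_measure_incseq[OF _ inc])
    show "range A \<subseteq> sets \<mu>" unfolding A_def by auto
    show "emeasure \<mu> (\<Union>n. A n) \<noteq> \<infinity>"
      unfolding un using emeasure_ball_finite[THEN less_imp_neq] by simp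
  qed
  then have "\<forall>\<^sub>F n in sequentially. a < measure \<mu> (A n)"
    using y unfolding un by (rule order_tendstoD)
  then obtain n where n: "a < measure \<mu> (A n)"
    by (auto simp: eventually_sequentially)
  show "\<exists>e>0. \<forall>z. dist z y < e \<longrightarrow> z \<in> {y. a < measure \<mu> (ball y r)}"
  proof (intro exI conjI allI impI)
    show "0 < 1 / real (Suc n)" by simp
    fix z assume z: "dist z y < 1 / real (Suc n)"
    \<comment> \<open>The gap \<open>1 / real (Suc n)\<close> between the radii absorbs the
      displacement of the centre from \<open>y\<close> to \<open>z\<close>.\<close>
    have "A n \<subseteq> ball z r"
    proof
      fix w assume "w \<in> A n"
      then show "w \<in> ball z r"
        using z dist_triangle[of z w y] unfolding A_def by simp
    qed
    then have "measure \<mu> (A n) \<le> measure \<mu> (ball z r)"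
      by (intro measure_mono_fmeasurable) (auto simp: A_def fmeasurable_def)
    with n show "z \<in> {y. a < measure \<mu> (ball y r)}" by simp
  qed
qed

text \<open>Makes the ratio in the SAMV integrand measurable, without which domination would not
  give integrability.\<close>

lemma borel_measurable_measure_ball:
  "(\<lambda>y. measure \<mu> (ball y r)) \<in> borel_measurable (completion \<mu>)"
proof (rule measurable_completion)
  have "(\<lambda>y. measure \<mu> (ball y r)) \<in> borel_measurable borel"
    using open_superlevel_measure_ball by (intro borel_measurableI_greater) simp
  then show "(\<lambda>y. measure \<mu> (ball y r)) \<in> borel_measurable \<mu>"
    by (simp add: measurable_def sets_eq_borel sets_eq_imp_space_eq[OF sets_eq_borel])
qed

lemma set_integrable_const_ball: "set_integrable (completion \<mu>) (ball x r) (\<lambda>_. c :: real)"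
  unfolding set_integrable_def by (simp add: integrable_indicator_iff)

lemma mean_integral_ball_mono:
  assumes "set_integrable (completion \<mu>) (ball x r) f"
    and "set_integrable (completion \<mu>) (ball x r) g"
    and "\<And>y. y \<in> ball x r \<Longrightarrow> f y \<le> g y"
  shows "mean_integral \<mu> (ball x r) f \<le> mean_integral \<mu> (ball x r) g"
  unfolding mean_integral_def by (intro mult_left_mono set_integral_mono assms) auto

lemma mean_integral_ball_const:
  "0 < r \<Longrightarrow> mean_integral \<mu> (ball x r) (\<lambda>_. c) = c"
  using measure_ball_pos[of r x]
  by (simp add: mean_integral_def set_lebesgue_integral_def)

text \<open>Local integrability provides only some neighborhood of \<open>x\<close>, so balls are
  controlled only once they fit inside it.\<close>

lemma eventually_set_integrable_ball:
  assumes "u \<in> L1_loc \<mu>"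
  shows "\<forall>\<^sub>F r in at_right 0. set_integrable (completion \<mu>) (ball x r) u"
proof -
  obtain U where U: "open U" "x \<in> U" "set_integrable (completion \<mu>) U u"
    using assms unfolding L1_loc_def by blast
  then obtain e where e: "e > 0" "ball x e \<subseteq> U" by (meson openE)
  have "\<forall>\<^sub>F r in at_right 0. r < e"
    using e(1) by (rule eventually_at_right_real[THEN eventually_mono]) simp
  then show ?thesis
  proof eventually_elim
    case (elim r)
    then have "ball x r \<subseteq> U" using e(2) subset_ball[of r e x] by auto
    then show ?case using U(3) by (intro set_integrable_subset[OF U(3)]) auto
  qed
qed

text \<open>Averaging the triangle inequality \<open>\<bar>c - d\<bar> \<le> \<bar>u y - c\<bar> +
  \<bar>u y - d\<bar>\<close> over small balls bounds a constant by a quantity tending to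
  zero.\<close>

lemma is_Lebesgue_value_unique:
  assumes u: "u \<in> L1_loc \<mu>"
    and c: "is_Lebesgue_value \<mu> u x c" and d: "is_Lebesgue_value \<mu> u x d"
  shows "c = d"
proof -
  have lim: "((\<lambda>r. mean_integral \<mu> (ball x r) (\<lambda>y. \<bar>u y - c\<bar>)
      + mean_integral \<mu> (ball x r) (\<lambda>y. \<bar>u y - d\<bar>)) \<longlongrightarrow> 0 + 0) (at_right 0)"
    using c d unfolding is_Lebesgue_value_def by (rule tendsto_add)
  have "\<forall>\<^sub>F r in at_right 0. \<bar>c - d\<bar> \<le> mean_integral \<mu> (ball x r) (\<lambda>y. \<bar>u y - c\<bar>)
      + mean_integral \<mu> (ball x r) (\<lambda>y. \<bar>u y - d\<bar>)"
    using eventually_set_integrable_ball[OF u, of x] eventually_at_right_less[of 0]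
  proof eventually_elim
    case (elim r)
    have I: "set_integrable (completion \<mu>) (ball x r) (\<lambda>y. \<bar>u y - e\<bar>)" for e
      by (intro set_integrable_abs set_integral_diff elim set_integrable_const_ball)
    have "\<bar>c - d\<bar> = mean_integral \<mu> (ball x r) (\<lambda>_. \<bar>c - d\<bar>)"
      using elim by (simp add: mean_integral_ball_const)
    also have "\<dots> \<le> mean_integral \<mu> (ball x r) (\<lambda>y. \<bar>u y - c\<bar> + \<bar>u y - d\<bar>)"
      by (intro mean_integral_ball_mono set_integral_add I set_integrable_const_ball) auto
    also have "\<dots> = mean_integral \<mu> (ball x r) (\<lambda>y. \<bar>u y - c\<bar>)
        + mean_integral \<mu> (ball x r) (\<lambda>y. \<bar>u y - d\<bar>)"
      using I by (simp add: mean_integral_def set_integral_add distrib_left)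
    finally show ?case .
  qed
  then have "\<bar>c - d\<bar> \<le> 0 + 0"
    by (intro tendsto_lowerbound[OF lim]) auto
  then show ?thesis by simp
qed

text \<open>Justifies the definite description: membership in \<open>Leb\<close> gives existence,
  the previous lemma uniqueness.\<close>

lemma is_Lebesgue_value_Lebesgue_value:
  assumes "u \<in> L1_loc \<mu>" and "x \<in> Leb \<mu> u"
  shows "is_Lebesgue_value \<mu> u x (Lebesgue_value \<mu> u x)"
proof -
  obtain c where "is_Lebesgue_value \<mu> u x c" using assms(2) unfolding Leb_def by blast
  then show ?thesis
    unfolding Lebesgue_value_def using is_Lebesgue_value_unique[OF assms(1)] by (blast intro: theI)
qed

text \<open>The deviation bound \<open>C * r\<^sup>2\<close> cancels the prefactor
  \<open>1 / (2 * r\<^sup>2)\<close>, leaving a constant times the mean oscillation at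
  \<open>x\<close>.\<close>

lemma Laplacian_at_scale_difference_le:
  assumes u: "u \<in> borel_measurable (completion \<mu>)"
    and int: "set_integrable (completion \<mu>) (ball x r) u"
    and r: "0 < r"
    and dev: "ball_ratio_deviation \<mu> x r \<le> ereal (C * r\<^sup>2)"
  shows "\<bar>AMV_Laplacian_at_scale \<mu> r u x - SAMV_Laplacian_at_scale \<mu> r u x\<bar>
    \<le> C / 2 * mean_integral \<mu> (ball x r) (\<lambda>y. \<bar>u y - Lebesgue_value \<mu> u x\<bar>)"
proof -
  let ?M = "completion \<mu>" and ?B = "ball x r"
  define v where "v y = u y - Lebesgue_value \<mu> u x" for y
  define \<rho> where "\<rho> y = measure \<mu> ?B / measure \<mu> (ball y r)" for y
  have \<rho>: "\<bar>1 - \<rho> y\<bar> \<le> C * r\<^sup>2" if "y \<in> ?B" for y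
  proof -
    \<comment> \<open>The supremum lives in \<open>ereal\<close>, so comparing a term with it
      requires no boundedness argument.\<close>
    have "ereal \<bar>1 - \<rho> y\<bar> \<le> ball_ratio_deviation \<mu> x r"
      unfolding ball_ratio_deviation_def \<rho>_def using that by (intro SUP_upper)
    then have "ereal \<bar>1 - \<rho> y\<bar> \<le> ereal (C * r\<^sup>2)" using dev by (rule order_trans)
    then show ?thesis by simp
  qed
  have [measurable]: "v \<in> borel_measurable ?M" "\<rho> \<in> borel_measurable ?M"
    unfolding v_def \<rho>_def using u borel_measurable_measure_ball by measurable
  have [measurable]: "?B \<in> sets ?M" by simp
  have v: "set_integrable ?M ?B v"
    unfolding v_def by (intro set_integral_diff int set_integrable_const_ball)
  have bound: "set_integrable ?M ?B (\<lambda>y. C * r\<^sup>2 * \<bar>v y\<bar>)"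
    using v by (intro set_integrable_mult_right set_integrable_abs) auto
  have le: "\<bar>v y * (1 - \<rho> y)\<bar> \<le> C * r\<^sup>2 * \<bar>v y\<bar>" if "y \<in> ?B" for y
    using mult_right_mono[OF \<rho>[OF that], of "\<bar>v y\<bar>"] by (simp add: abs_mult mult.commute)
  have w: "set_integrable ?M ?B (\<lambda>y. v y * (1 - \<rho> y))"
  proof (rule set_integrable_bound[OF bound])
    show "set_borel_measurable ?M ?B (\<lambda>y. v y * (1 - \<rho> y))"
      unfolding set_borel_measurable_def by measurable
    show "AE y in ?M. y \<in> ?B \<longrightarrow> norm (v y * (1 - \<rho> y)) \<le> norm (C * r\<^sup>2 * \<bar>v y\<bar>)"
      \<comment> \<open>\<open>le\<close> bounds by the value of the dominating function; its norm
        is at least as large, whatever the sign of \<open>C\<close>.\<close>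
      using le by (intro AE_I2) (force intro: order_trans[OF _ abs_ge_self])
  qed
  \<comment> \<open>Writing \<open>1 + \<rho> y\<close> as \<open>2 - (1 - \<rho> y)\<close>
    isolates twice the AMV integral; the remainder carries the small factor.\<close>
  have "(LINT y:?B|?M. v y * (1 + \<rho> y)) = (LINT y:?B|?M. 2 * v y - v y * (1 - \<rho> y))"
    by (simp add: algebra_simps)
  also have "\<dots> = 2 * (LINT y:?B|?M. v y) - (LINT y:?B|?M. v y * (1 - \<rho> y))"
    using v w by simp
  finally have "AMV_Laplacian_at_scale \<mu> r u x - SAMV_Laplacian_at_scale \<mu> r u x
      = 1 / (2 * r\<^sup>2) * mean_integral \<mu> ?B (\<lambda>y. v y * (1 - \<rho> y))"
    unfolding AMV_Laplacian_at_scale_def SAMV_Laplacian_at_scale_def mean_integral_def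
      v_def[symmetric] \<rho>_def[symmetric] by (simp add: right_diff_distrib)
  also have "\<bar>\<dots>\<bar> = 1 / (2 * r\<^sup>2) * \<bar>mean_integral \<mu> ?B (\<lambda>y. v y * (1 - \<rho> y))\<bar>"
    by (simp add: abs_mult)
  also have "\<dots> \<le> 1 / (2 * r\<^sup>2) * mean_integral \<mu> ?B (\<lambda>y. C * r\<^sup>2 * \<bar>v y\<bar>)"
  proof (rule mult_left_mono)
    have "\<bar>mean_integral \<mu> ?B (\<lambda>y. v y * (1 - \<rho> y))\<bar>
        \<le> mean_integral \<mu> ?B (\<lambda>y. \<bar>v y * (1 - \<rho> y)\<bar>)"
      using set_integral_norm_bound[OF w]
      by (simp add: mean_integral_def abs_mult divide_right_mono)
    also have "\<dots> \<le> mean_integral \<mu> ?B (\<lambda>y. C * r\<^sup>2 * \<bar>v y\<bar>)"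
      by (intro mean_integral_ball_mono set_integrable_abs w bound le)
    finally show "\<bar>mean_integral \<mu> ?B (\<lambda>y. v y * (1 - \<rho> y))\<bar>
        \<le> mean_integral \<mu> ?B (\<lambda>y. C * r\<^sup>2 * \<bar>v y\<bar>)" .
  qed simp
  also have "\<dots> = C / 2 * mean_integral \<mu> ?B (\<lambda>y. \<bar>v y\<bar>)"
    using r by (simp add: mean_integral_def)
  finally show ?thesis unfolding v_def .
qed

text \<open>A squeeze: \<open>C\<close> does not depend on \<open>r\<close>, and the mean
  oscillation vanishes in the limit because \<open>x\<close> is a Lebesgue point.\<close>

lemma tendsto_Laplacian_at_scale_difference:
  assumes u: "u \<in> L1_loc \<mu>" and x: "x \<in> Leb \<mu> u"
    and dev: "\<forall>\<^sub>F r in at_right 0. ball_ratio_deviation \<mu> x r \<le> ereal (C * r\<^sup>2)"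
  shows "((\<lambda>r. AMV_Laplacian_at_scale \<mu> r u x - SAMV_Laplacian_at_scale \<mu> r u x)
    \<longlongrightarrow> 0) (at_right 0)"
proof (rule Lim_null_comparison)
  have meas: "u \<in> borel_measurable (completion \<mu>)" using u unfolding L1_loc_def by simp
  show "\<forall>\<^sub>F r in at_right 0.
      norm (AMV_Laplacian_at_scale \<mu> r u x - SAMV_Laplacian_at_scale \<mu> r u x)
        \<le> C / 2 * mean_integral \<mu> (ball x r) (\<lambda>y. \<bar>u y - Lebesgue_value \<mu> u x\<bar>)"
    using eventually_set_integrable_ball[OF u, of x] eventually_at_right_less[of 0] dev
    by eventually_elim (simp only: real_norm_def Laplacian_at_scale_difference_le[OF meas])
  show "((\<lambda>r. C / 2 * mean_integral \<mu> (ball x r) (\<lambda>y. \<bar>u y - Lebesgue_value \<mu> u x\<bar>))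
      \<longlongrightarrow> 0) (at_right 0)"
    using is_Lebesgue_value_Lebesgue_value[OF u x] unfolding is_Lebesgue_value_def
    by (rule tendsto_mult_right_zero)
qed

end

theorem proposition4p2:
  fixes \<mu> :: "'a::metric_space measure" and u :: "'a \<Rightarrow> real" and x :: 'a
  assumes "metric_measure_space \<mu>"
    and "u \<in> L1_loc \<mu>"
    and "x \<in> Leb \<mu> u"
    and "\<exists>C::real. \<forall>\<^sub>F r in at_right 0. ball_ratio_deviation \<mu> x r \<le> ereal (C * r\<^sup>2)"
  shows "((\<lambda>r. \<bar>AMV_Laplacian_at_scale \<mu> r u x - SAMV_Laplacian_at_scale \<mu> r u x\<bar>)
            \<longlongrightarrow> 0) (at_right 0)
    \<and> ((\<exists>L. ((\<lambda>r. AMV_Laplacian_at_scale \<mu> r u x) \<longlongrightarrow> L) (at_right 0))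
         \<longleftrightarrow> (\<exists>L. ((\<lambda>r. SAMV_Laplacian_at_scale \<mu> r u x) \<longlongrightarrow> L) (at_right 0)))
    \<and> ((\<exists>L. ((\<lambda>r. AMV_Laplacian_at_scale \<mu> r u x) \<longlongrightarrow> L) (at_right 0))
         \<longrightarrow> AMV_Laplacian \<mu> u x = SAMV_Laplacian \<mu> u x)"
proof -
  interpret metric_measure_space \<mu> by fact
  have diff: "((\<lambda>r. AMV_Laplacian_at_scale \<mu> r u x - SAMV_Laplacian_at_scale \<mu> r u x)
      \<longlongrightarrow> 0) (at_right 0)"
    using assms(4) tendsto_Laplacian_at_scale_difference[OF assms(2,3)] by blast
  \<comment> \<open>Fixing the candidate \<open>L\<close> is stronger than comparing existence of
    limits: it also makes the limits agree.\<close>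
  have iff: "((\<lambda>r. AMV_Laplacian_at_scale \<mu> r u x) \<longlongrightarrow> L) (at_right 0)
      \<longleftrightarrow> ((\<lambda>r. SAMV_Laplacian_at_scale \<mu> r u x) \<longlongrightarrow> L) (at_right 0)" for L
    using Lim_transform[OF _ diff] Lim_transform2[OF _ diff] by blast
  show ?thesis
    \<comment> \<open>\<open>Lim\<close> is a definite description over limits, so rewriting with
      \<open>iff\<close> turns both Laplacians into the same term.\<close>
    unfolding AMV_Laplacian_def SAMV_Laplacian_def Topological_Spaces.Lim_def iff
    using diff by (simp add: tendsto_rabs_zero_iff)
qed

end
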